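(* Let $\varphi_l, g_i, h_j\in C^{1,1}(\mathbb{R}^n)$ for $l\in L=\{1,\dots,q\}$, $i\in I=\{1,\dots,m\}$, $j\in J=\{1,\dots,p\}$, and consider the multiobjective problem (MP) of minimizing, with respect to the cone $\mathbb{R}^q_+$, the map $\varphi(x)=(\varphi_1(x),\dots,\varphi_q(x))$ over $x\in X:=\{x\in\mathbb{R}^n\mid g_i(x)\le0,\ i\in I,\ h_j(x)=0,\ j\in J\}$. Suppose that $\bar x\in X$ is a stationary point of (MP) and $(\bar\alpha,\bar\lambda,\bar\mu)\in\mathrm{A}(\bar x)$. Assume that for every $v\in[T(\bar x,X)\cap K(\bar x)]\setminus\{0\}$ and for any $z\in\partial^2\mathcal{L}(\bar x,\bar\alpha,\bar\lambda,\bar\mu)(v)$ one has $$\langle z,v\rangle>0.$$ Then $\bar x$ is an isolated local solution of order $2$ of (MP).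
   Context: All spaces are finite-dimensional Euclidean spaces with inner product $\langle\cdot,\cdot\rangle$ and norm $\|\cdot\|$. $C^{1,1}(\mathbb{R}^n)$ is the class of real-valued Fréchet differentiable functions on $\mathbb{R}^n$ whose gradient mapping is locally Lipschitz. Active index set: $I^0(x):=\{i\in I\mid g_i(x)=0\}$. $K(x)$, for $x\in X$, is the set of critical directions of (MP) at $x$, i.e. of all $v\in\mathbb{R}^n$ such that $\langle\nabla\varphi_l(x),v\rangle\le0$ for all $l\in L$, $\langle\nabla\varphi_l(x),v\rangle=0$ for at least one $l\in L$, $\langle\nabla g_i(x),v\rangle\le0$ for all $i\in I^0(x)$, and $\langle\nabla h_j(x),v\rangle=0$ for all $j\in J$. Contingent cone: for $\Omega\subset\mathbb{R}^n$ and $\bar x\in\Omega$, $v\in T(\bar x,\Omega)$ iff there exist $t_k\to0^+$ (with $t_k>0$) and $v_k\to v$ such that $\bar x+t_kv_k\in\Omega$ for every $k\in\mathbb{N}$. Lagrangian: $\mathcal{L}(x,\alpha,\lambda,\mu)=\sum_{l\in L}\alpha_l\varphi_l(x)+\sum_{i\in I}\lambda_ig_i(x)+\sum_{j\in J}\mu_jh_j(x)$. Set of Lagrange multipliers of (MP) at $\bar x\in X$: $$\mathrm{A}(\bar x):=\{(\bar\alpha,\bar\lambda,\bar\mu)\in(\mathbb{R}^q_+\setminus\{0\})\times\mathbb{R}^m_+\times\mathbb{R}^p\mid\nabla_x\mathcal{L}(\bar x,\bar\alpha,\bar\lambda,\bar\mu)=0,\ \bar\lambda_ig_i(\bar x)=0,\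 i\in I\}.$$ A point $\bar x\in X$ is a stationary point of (MP) if $\mathrm{A}(\bar x)\ne\emptyset$. Isolated local solution of order 2 of (MP): a point $\bar x\in X$ for which there exist $\beta>0$ and a neighborhood $U$ of $\bar x$ such that $\max\{\varphi_1(x)-\varphi_1(\bar x),\dots,\varphi_q(x)-\varphi_q(\bar x)\}\ge\beta\|x-\bar x\|^2$ for all $x\in X\cap U$. Normal cones: for $\Omega\subset\mathbb{R}^n$ and $\bar x\in\Omega$, the Fréchet normal cone is $\widehat N(\bar x,\Omega)=\{v\mid\limsup_{x\to\bar x,\,x\in\Omega}\langle v,x-\bar x\rangle/\|x-\bar x\|\le0\}$, and the limiting (Mordukhovich) normal cone $N(\bar x,\Omega)$ is the set of all $v$ for which there exist $x_k\to\bar x$, $x_k\in\Omega$, and $v_k\in\widehat N(x_k,\Omega)$ with $v_k\to v$. Limiting second-order subdifferential: for $\phi\in C^{1,1}(\mathbb{R}^n)$ (so that the limiting subdifferential $\partial\phi(x)$ equals $\{\nabla\phi(x)\}$), it is the limiting coderivative of the gradient mapping: $$\partial^2\phi(\bar x)(v)=\{u\in\mathbb{R}^n\mid(u,-v)\in N((\bar x,\nabla\phi(\bar x)),\mathrm{gph}\,\nabla\phi)\},\quad v\in\mathbb{R}^n.$$ $\partial^2\mathcal{L}(\bar x,\bar\alpha,\bar\lambda,\bar\mu)(v)$ denotes the limiting second-order subdifferential at $\bar x$ of the function $x\mapsto\mathcal{L}(x,\bar\alpha,\bar\lambda,\bar\mu)$, evaluated at $v$. *)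

theory Defs
  imports "HOL-Analysis.Analysis"
begin

section \<open>Gradients and the class of differentiable functions with locally Lipschitz gradient\<close>

text \<open>The Euclidean space is an arbitrary type of class \<open>euclidean_space\<close>.\<close>

definition gradient :: "('a::euclidean_space \<Rightarrow> real) \<Rightarrow> 'a \<Rightarrow> 'a" where
  "gradient f x = (THE D. GDERIV f x :> D)"

lemma GDERIV_gradient:
  fixes f :: "'a::euclidean_space \<Rightarrow> real"
  assumes "f differentiable (at x)"
  shows "GDERIV f x :> gradient f x"
proof -
  obtain f' where f': "(f has_derivative f') (at x)"
    using assms by (auto simp: differentiable_def)
  then interpret linear f' by (rule has_derivative_linear)
  have "f' = (\<lambda>h. h \<bullet> adjoint f' 1)"
    using adjoint_works[OF linear_axioms] by (auto simp: fun_eq_iff)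
  with f' have D: "GDERIV f x :> adjoint f' 1"
    by (simp add: gderiv_def)
  moreover have "D' = adjoint f' 1" if "GDERIV f x :> D'" for D'
  proof -
    have "(\<lambda>h. h \<bullet> D') = (\<lambda>h. h \<bullet> adjoint f' 1)"
      using that D unfolding gderiv_def by (rule has_derivative_unique)
    then show ?thesis
      by (metis inner_commute vector_eq_ldot)
  qed
  ultimately show ?thesis
    unfolding gradient_def by (rule theI)
qed

definition C11 :: "('a::euclidean_space \<Rightarrow> real) \<Rightarrow> bool" where
  "C11 f \<longleftrightarrow> (\<forall>x. f differentiable (at x)) \<and>
     (\<forall>x. \<exists>e>0. \<exists>C. C-lipschitz_on (ball x e) (gradient f))"

section \<open>Tangent and normal cones, second-order subdifferential\<close>

definition contingent_cone :: "'a::euclidean_space \<Rightarrow> 'a set \<Rightarrow> 'a set" where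
  "contingent_cone x \<Omega> = {v. \<exists>(t :: nat \<Rightarrow> real) w.
     (\<forall>k. t k > 0) \<and> t \<longlonglongrightarrow> 0 \<and> w \<longlonglongrightarrow> v \<and> (\<forall>k. x + t k *\<^sub>R w k \<in> \<Omega>)}"

text \<open>
  The upper limit is taken in the extended reals, over points of \<open>\<Omega>\<close> different from \<open>x\<close>.
  At an isolated point of \<open>\<Omega>\<close> the filter is trivial, the upper limit is \<open>-\<infinity>\<close>, and the
  cone is the whole space.
\<close>

definition frechet_normal_cone :: "'a::euclidean_space \<Rightarrow> 'a set \<Rightarrow> 'a set" where
  "frechet_normal_cone x \<Omega> =
     {v. Limsup (at x within \<Omega>) (\<lambda>y. ereal (v \<bullet> (y - x) / norm (y - x))) \<le> 0}"

definition limiting_normal_cone :: "'a::euclidean_space \<Rightarrow> 'a set \<Rightarrow> 'a set" where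
  "limiting_normal_cone x \<Omega> = {v. \<exists>(y :: nat \<Rightarrow> 'a) w.
     y \<longlonglongrightarrow> x \<and> (\<forall>k. y k \<in> \<Omega>) \<and> (\<forall>k. w k \<in> frechet_normal_cone (y k) \<Omega>) \<and> w \<longlonglongrightarrow> v}"

text \<open>Meaningful for functions of class \<open>C11\<close>: the limiting coderivative of the gradient map.\<close>

definition limiting_second_subdiff ::
    "('a::euclidean_space \<Rightarrow> real) \<Rightarrow> 'a \<Rightarrow> 'a \<Rightarrow> 'a set" where
  "limiting_second_subdiff f x v =
     {u. (u, - v) \<in> limiting_normal_cone (x, gradient f x) (range (\<lambda>y. (y, gradient f y)))}"

section \<open>The multiobjective problem\<close>

text \<open>
  The data are \<open>q\<close> objectives \<open>\<phi> l\<close>, \<open>m\<close> inequality constraints \<open>g i\<close> and \<open>p\<close> equality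
  constraints \<open>h j\<close>. Index sets are \<open>{1..q}\<close>, \<open>{1..m}\<close>, \<open>{1..p}\<close>; families of functions and
  vectors of multipliers are functions on \<^typ>\<open>nat\<close> whose values outside the index set are
  never used.
\<close>

definition feasible_set ::
    "nat \<Rightarrow> nat \<Rightarrow> (nat \<Rightarrow> 'a::euclidean_space \<Rightarrow> real) \<Rightarrow> (nat \<Rightarrow> 'a \<Rightarrow> real) \<Rightarrow> 'a set" where
  "feasible_set m p g h = {x. (\<forall>i\<in>{1..m}. g i x \<le> 0) \<and> (\<forall>j\<in>{1..p}. h j x = 0)}"

definition active_set :: "nat \<Rightarrow> (nat \<Rightarrow> 'a::euclidean_space \<Rightarrow> real) \<Rightarrow> 'a \<Rightarrow> nat set" where
  "active_set m g x = {i \<in> {1..m}. g i x = 0}"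

definition critical_directions ::
    "nat \<Rightarrow> nat \<Rightarrow> nat \<Rightarrow> (nat \<Rightarrow> 'a::euclidean_space \<Rightarrow> real) \<Rightarrow> (nat \<Rightarrow> 'a \<Rightarrow> real) \<Rightarrow>
     (nat \<Rightarrow> 'a \<Rightarrow> real) \<Rightarrow> 'a \<Rightarrow> 'a set" where
  "critical_directions q m p \<phi> g h x = {v.
     (\<forall>l\<in>{1..q}. gradient (\<phi> l) x \<bullet> v \<le> 0) \<and>
     (\<exists>l\<in>{1..q}. gradient (\<phi> l) x \<bullet> v = 0) \<and>
     (\<forall>i\<in>active_set m g x. gradient (g i) x \<bullet> v \<le> 0) \<and>
     (\<forall>j\<in>{1..p}. gradient (h j) x \<bullet> v = 0)}"

definition lagrangian ::
    "nat \<Rightarrow> nat \<Rightarrow> nat \<Rightarrow> (nat \<Rightarrow> 'a::euclidean_space \<Rightarrow> real) \<Rightarrow> (nat \<Rightarrow> 'a \<Rightarrow> real) \<Rightarrow>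
     (nat \<Rightarrow> 'a \<Rightarrow> real) \<Rightarrow> 'a \<Rightarrow> (nat \<Rightarrow> real) \<Rightarrow> (nat \<Rightarrow> real) \<Rightarrow> (nat \<Rightarrow> real) \<Rightarrow> real" where
  "lagrangian q m p \<phi> g h x \<alpha> lam \<mu> =
     (\<Sum>l\<in>{1..q}. \<alpha> l * \<phi> l x) + (\<Sum>i\<in>{1..m}. lam i * g i x) + (\<Sum>j\<in>{1..p}. \<mu> j * h j x)"

definition multipliers ::
    "nat \<Rightarrow> nat \<Rightarrow> nat \<Rightarrow> (nat \<Rightarrow> 'a::euclidean_space \<Rightarrow> real) \<Rightarrow> (nat \<Rightarrow> 'a \<Rightarrow> real) \<Rightarrow>
     (nat \<Rightarrow> 'a \<Rightarrow> real) \<Rightarrow> 'a \<Rightarrow> ((nat \<Rightarrow> real) \<times> (nat \<Rightarrow> real) \<times> (nat \<Rightarrow> real)) set" where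
  "multipliers q m p \<phi> g h x = {(\<alpha>, lam, \<mu>).
     (\<forall>l\<in>{1..q}. \<alpha> l \<ge> 0) \<and> (\<exists>l\<in>{1..q}. \<alpha> l \<noteq> 0) \<and>
     (\<forall>i\<in>{1..m}. lam i \<ge> 0) \<and>
     gradient (\<lambda>y. lagrangian q m p \<phi> g h y \<alpha> lam \<mu>) x = 0 \<and>
     (\<forall>i\<in>{1..m}. lam i * g i x = 0)}"

definition stationary_point ::
    "nat \<Rightarrow> nat \<Rightarrow> nat \<Rightarrow> (nat \<Rightarrow> 'a::euclidean_space \<Rightarrow> real) \<Rightarrow> (nat \<Rightarrow> 'a \<Rightarrow> real) \<Rightarrow>
     (nat \<Rightarrow> 'a \<Rightarrow> real) \<Rightarrow> 'a \<Rightarrow> bool" where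
  "stationary_point q m p \<phi> g h x \<longleftrightarrow>
     x \<in> feasible_set m p g h \<and> multipliers q m p \<phi> g h x \<noteq> {}"

text \<open>Meaningful for \<open>q \<ge> 1\<close>, which nonemptiness of the multiplier set guarantees.\<close>

definition isolated_local_solution_order2 ::
    "nat \<Rightarrow> nat \<Rightarrow> nat \<Rightarrow> (nat \<Rightarrow> 'a::euclidean_space \<Rightarrow> real) \<Rightarrow> (nat \<Rightarrow> 'a \<Rightarrow> real) \<Rightarrow>
     (nat \<Rightarrow> 'a \<Rightarrow> real) \<Rightarrow> 'a \<Rightarrow> bool" where
  "isolated_local_solution_order2 q m p \<phi> g h x0 \<longleftrightarrow>
     x0 \<in> feasible_set m p g h \<and>
     (\<exists>\<beta>>0. \<exists>U. open U \<and> x0 \<in> U \<and>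
        (\<forall>x \<in> feasible_set m p g h \<inter> U.
           Max ((\<lambda>l. \<phi> l x - \<phi> l x0) ` {1..q}) \<ge> \<beta> * (norm (x - x0))\<^sup>2))"

end

theory Submission
  imports Defs
begin

text \<open>
  The idea is to argue by contradiction along a sequence of feasible points. If \<open>x0\<close> is not an
  isolated local solution of order two, then there are feasible points \<open>x k \<noteq> x0\<close> tending to \<open>x0\<close>
  at which no objective grows by more than \<open>o(norm (x k - x0)^2)\<close>, and by compactness of the unit
  sphere their directions \<open>sgn (x k - x0)\<close> may be assumed to converge to some \<open>v\<close> of norm one.
  This \<open>v\<close> is tangent to the feasible set by construction. First-order expansion of the data
  shows that no objective and no active constraint increases along \<open>v\<close>; stationarity makes a
  nonnegative combination of these nonpositive slopes vanish, so that an objective with a positive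
  multiplier has slope zero and \<open>v\<close> is critical.

  The signs of the multipliers also turn the bound on the objectives into
  \<open>F (x k) - F x0 \<le> o(norm (x k - x0)^2)\<close> for the Lagrangian \<open>F\<close>, whose gradient vanishes at \<open>x0\<close>.
  What remains is purely a fact on \<open>F\<close>: such a sequence forces a \<open>z\<close> in the limiting second-order
  subdifferential at \<open>(x0, v)\<close> with \<open>z \<bullet> v \<le> 0\<close> (lemma \<open>limiting_second_subdiff_nonpos\<close>), against
  the hypothesis.

  To find \<open>z\<close>, let \<open>w = sgn (x k - x0)\<close>. By the classical mean value theorem the function
  \<open>y \<mapsto> w \<bullet> gradient F y\<close> hardly grows between \<open>x0\<close> and some point of the segment to \<open>x k\<close>. This
  function is only Lipschitz, so a nonsmooth mean value inequality is needed, which yields a nearby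
  point \<open>y\<close> and a proximal subgradient \<open>u\<close> there with \<open>u \<bullet> w\<close> almost nonpositive (lemma
  \<open>proximal_mean_value\<close>). A proximal subgradient \<open>u\<close> of \<open>w \<bullet> gradient F\<close> gives the Frechet
  normal \<open>(u, - w)\<close> to the graph of \<open>gradient F\<close> (lemma \<open>frechet_normal_graph\<close>). The
  vectors \<open>u\<close> are bounded by the Lipschitz constant, and \<open>z\<close> is one of their limit points.
\<close>

section \<open>Calculus of gradients\<close>

lemma gradient_eqI:
  assumes "GDERIV f x :> D"
  shows "gradient f x = D"
proof -
  have "f differentiable (at x)"
    using assms unfolding gderiv_def differentiable_def by blast
  then have "(\<lambda>h. h \<bullet> gradient f x) = (\<lambda>h. h \<bullet> D)"
    using GDERIV_gradient assms unfolding gderiv_def by (metis has_derivative_unique)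
  then show ?thesis
    by (metis inner_commute vector_eq_ldot)
qed

lemma C11_GDERIV: "C11 f \<Longrightarrow> GDERIV f x :> gradient f x"
  by (simp add: C11_def GDERIV_gradient)

lemma C11_locally_lipschitz:
  assumes "C11 f"
  obtains e C where "e > 0" "C-lipschitz_on (ball x e) (gradient f)"
  using assms unfolding C11_def by meson

lemma C11I:
  assumes D: "\<And>x. GDERIV f x :> G x"
    and lip: "\<And>x. \<exists>e>0. \<exists>C. C-lipschitz_on (ball x e) G"
  shows "C11 f"
proof -
  have "gradient f = G"
    using D gradient_eqI by blast
  moreover have "f differentiable (at x)" for x
    using D[of x] unfolding gderiv_def differentiable_def by blast
  ultimately show ?thesis
    using lip by (simp add: C11_def)
qed

lemma C11_add:
  assumes f: "C11 f" and g: "C11 g"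
  shows "C11 (\<lambda>x. f x + g x)"
proof (rule C11I)
  show "GDERIV (\<lambda>x. f x + g x) x :> gradient f x + gradient g x" for x
    using f g by (intro GDERIV_add C11_GDERIV)
  fix x
  obtain e1 C1 where 1: "e1 > 0" "C1-lipschitz_on (ball x e1) (gradient f)"
    using C11_locally_lipschitz[OF f] by blast
  obtain e2 C2 where 2: "e2 > 0" "C2-lipschitz_on (ball x e2) (gradient g)"
    using C11_locally_lipschitz[OF g] by blast
  have "(C1 + C2)-lipschitz_on (ball x (min e1 e2)) (\<lambda>x. gradient f x + gradient g x)"
    by (intro lipschitz_on_add lipschitz_on_subset[OF 1(2)] lipschitz_on_subset[OF 2(2)]) auto
  then show "\<exists>e>0. \<exists>C. C-lipschitz_on (ball x e) (\<lambda>x. gradient f x + gradient g x)"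
    using 1(1) 2(1) by (intro exI[of _ "min e1 e2"]) auto
qed

lemma C11_cmult:
  fixes c :: real
  assumes f: "C11 f"
  shows "C11 (\<lambda>x. c * f x)"
proof (rule C11I)
  show "GDERIV (\<lambda>x. c * f x) x :> c *\<^sub>R gradient f x" for x
    using C11_GDERIV[OF f, of x] unfolding gderiv_def
    by (auto intro!: derivative_eq_intros)
  fix x
  obtain e C where 1: "e > 0" "C-lipschitz_on (ball x e) (gradient f)"
    using C11_locally_lipschitz[OF f] by blast
  have "(\<bar>c\<bar> * C)-lipschitz_on (ball x e) (\<lambda>x. c *\<^sub>R gradient f x)"
    by (intro lipschitz_on_cmult 1)
  then show "\<exists>e>0. \<exists>C. C-lipschitz_on (ball x e) (\<lambda>x. c *\<^sub>R gradient f x)"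
    using 1(1) by blast
qed

lemma C11_zero: "C11 (\<lambda>x :: 'a::euclidean_space. 0)"
proof (rule C11I)
  show "GDERIV (\<lambda>x. 0) x :> 0" for x :: 'a
    by (rule GDERIV_const)
  have "0-lipschitz_on (ball x 1) (\<lambda>_. 0 :: 'a)" for x :: 'a
    by (rule lipschitz_on_constant)
  then show "\<exists>e>0. \<exists>C. C-lipschitz_on (ball x e) (\<lambda>_. 0 :: 'a)" for x :: 'a
    using zero_less_one by blast
qed

lemma C11_sum:
  assumes "\<And>i. i \<in> S \<Longrightarrow> C11 (f i)"
  shows "C11 (\<lambda>x. \<Sum>i\<in>S. f i x)"
  using assms
proof (induction S rule: infinite_finite_induct)
  case (insert i S)
  then show ?case
    by (simp add: C11_add)
qed (simp_all add: C11_zero)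

lemma C11_lagrangian:
  assumes "\<And>l. l \<in> {1..q} \<Longrightarrow> C11 (\<phi> l)"
    and "\<And>i. i \<in> {1..m} \<Longrightarrow> C11 (g i)"
    and "\<And>j. j \<in> {1..p} \<Longrightarrow> C11 (h j)"
  shows "C11 (\<lambda>x. lagrangian q m p \<phi> g h x \<alpha> lam \<mu>)"
  unfolding lagrangian_def by (intro C11_add C11_sum C11_cmult assms)

text \<open>
  The remainder in the definition of the derivative is already divided by the distance, so the
  difference quotient is that remainder plus \<open>D\<close> applied to the unit direction. The lemma turns
  growth estimates along a sequence into signs of slopes along its limit direction.
\<close>

lemma GDERIV_directional_limit:
  fixes f :: "'a::euclidean_space \<Rightarrow> real"
  assumes D: "GDERIV f x0 :> D"
    and x: "x \<longlonglongrightarrow> x0" "\<And>k. x k \<noteq> x0"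
    and v: "(\<lambda>k. sgn (x k - x0)) \<longlonglongrightarrow> v"
  shows "(\<lambda>k. (f (x k) - f x0) / norm (x k - x0)) \<longlonglongrightarrow> D \<bullet> v"
proof -
  let ?R = "\<lambda>y. (f y - f x0 - (y - x0) \<bullet> D) /\<^sub>R norm (y - x0)"
  have "?R \<midarrow>x0\<rightarrow> 0"
    using D unfolding gderiv_def by (simp add: has_derivative_at_within)
  moreover have "filterlim x (at x0) sequentially"
    using x by (simp add: filterlim_at)
  ultimately have "(\<lambda>k. ?R (x k)) \<longlonglongrightarrow> 0"
    by (rule filterlim_compose)
  then have "(\<lambda>k. ?R (x k) + D \<bullet> sgn (x k - x0)) \<longlonglongrightarrow> 0 + D \<bullet> v"
    by (intro tendsto_intros v)
  moreover have "?R (x k) + D \<bullet> sgn (x k - x0) = (f (x k) - f x0) / norm (x k - x0)" for k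
    by (simp add: sgn_div_norm divide_inverse inner_commute algebra_simps)
  ultimately show ?thesis
    by simp
qed

section \<open>A nonsmooth mean value inequality\<close>

text \<open>
  This replaces the mean value theorem for Lipschitz functions. A minimiser of \<open>f\<close> on the segment
  is not a local minimiser in the whole space, and the endpoint \<open>b\<close> may be the only one, so the
  segment constraint is decoupled by the penalty
  \<open>N * norm (x - c)^2\<close>, minimised jointly over \<open>x\<close> in the ball and \<open>c\<close> in the segment. Optimality
  in \<open>x\<close> makes the gradient of the penalty, up to sign, a proximal subgradient of \<open>f\<close>. Optimality
  in \<open>c\<close> says that \<open>c\<close> is the projection of \<open>x\<close> on the segment. For large \<open>N\<close> it
  is not the endpoint \<open>a\<close>, where \<open>f\<close> is too large, so moving it towards \<open>a\<close> is admissible and does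
  not bring it closer to \<open>x\<close>; this yields the sign of \<open>u \<bullet> (b - a)\<close>.
\<close>

lemma proximal_mean_value:
  fixes f :: "'a::euclidean_space \<Rightarrow> real"
  assumes lip: "C-lipschitz_on (cball z e) f"
    and ab: "a \<in> ball z e" "b \<in> ball z e"
    and less: "f b < f a"
  obtains y u K where "y \<in> ball z e" "norm u \<le> 2 * C" "u \<bullet> (b - a) \<le> 0"
    "\<And>x. x \<in> ball z e \<Longrightarrow> u \<bullet> (x - y) - K * (norm (x - y))\<^sup>2 \<le> f x - f y"
proof -
  define S where "S = closed_segment a b"
  define \<rho> where "\<rho> = max (dist z a) (dist z b)"
  (* The first summand keeps the minimiser inside the open ball, the second one keeps its
     projection away from a. *)
  define N where "N = C / (e - \<rho>) + C\<^sup>2 / (f a - f b) + 1"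
  have C: "C \<ge> 0"
    using lip by (rule lipschitz_on_nonneg)
  have \<rho>: "\<rho> < e"
    using ab by (simp add: \<rho>_def)
  have S_\<rho>: "S \<subseteq> cball z \<rho>"
    unfolding S_def by (intro closed_segment_subset) (auto simp: \<rho>_def)
  then have S_ball: "S \<subseteq> cball z e"
    using \<rho> by auto
  have N: "N > 0" "N > C / (e - \<rho>)" "N > C\<^sup>2 / (f a - f b)"
  proof -
    have "C / (e - \<rho>) \<ge> 0" "C\<^sup>2 / (f a - f b) \<ge> 0"
      using C \<rho> less by auto
    then show "N > 0" "N > C / (e - \<rho>)" "N > C\<^sup>2 / (f a - f b)"
      unfolding N_def by linarith+
  qed
  have lipD: "f x - f y \<le> C * norm (y - x)" if "x \<in> cball z e" "y \<in> cball z e" for x y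
    using lipschitz_onD[OF lip that] by (simp add: dist_norm norm_minus_commute)
  let ?\<Phi> = "\<lambda>(x, c). f x + N * (norm (x - c))\<^sup>2"
  have "continuous_on (cball z e \<times> S) ?\<Phi>"
    unfolding case_prod_beta
    by (intro continuous_intros continuous_on_compose2[OF lipschitz_on_continuous_on[OF lip]]) auto
  moreover have "compact (cball z e \<times> S)"
    by (simp add: S_def compact_Times)
  moreover have "(a, a) \<in> cball z e \<times> S"
    using ab by (simp add: S_def)
  ultimately obtain y c where yc: "y \<in> cball z e" "c \<in> S"
    and min: "\<And>x d. x \<in> cball z e \<Longrightarrow> d \<in> S \<Longrightarrow>
      f y + N * (norm (y - c))\<^sup>2 \<le> f x + N * (norm (x - d))\<^sup>2"
    using continuous_attains_inf[of "cball z e \<times> S" ?\<Phi>] by fastforce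
  have c: "c \<in> cball z e"
    using yc S_ball by auto
  have NC: "N * norm (y - c) \<le> C"
  proof (cases "y = c")
    case False
    have "N * (norm (y - c))\<^sup>2 \<le> f c - f y"
      using min[OF c yc(2)] by simp
    also have "\<dots> \<le> C * norm (y - c)"
      by (rule lipD[OF c yc(1)])
    finally show ?thesis
      using False by (simp add: power2_eq_square)
  qed (simp add: C)
  then have yc_le: "norm (y - c) \<le> C / N"
    using N by (simp add: field_simps)
  have y: "y \<in> ball z e"
  proof -
    have "C / N < e - \<rho>"
      using N \<rho> by (simp add: field_simps)
    moreover have "dist z c \<le> \<rho>"
      using S_\<rho> yc by auto
    moreover have "dist z y \<le> dist z c + norm (y - c)"
      by (metis dist_commute dist_norm dist_triangle)
    ultimately show ?thesis
      using yc_le by simp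
  qed
  have "c \<noteq> a"
  proof
    assume "c = a"
    have "f y + N * (norm (y - c))\<^sup>2 \<le> f b"
      using min[of b b] ab by (simp add: S_def)
    moreover have "0 \<le> N * (norm (y - c))\<^sup>2"
      using N by simp
    moreover have "f a - f y \<le> C * norm (y - c)"
      using lipD[OF c yc(1)] \<open>c = a\<close> by simp
    moreover have "C * norm (y - c) \<le> C * (C / N)"
      using yc_le C by (rule mult_left_mono)
    moreover have "C * (C / N) < f a - f b"
      using N less by (simp add: field_simps power2_eq_square)
    ultimately show False
      by linarith
  qed
  then obtain \<tau> where \<tau>: "\<tau> > 0" "c - a = \<tau> *\<^sub>R (b - a)"
    using yc(2) unfolding S_def closed_segment_def
    by (force simp: algebra_simps less_le)
  have proj: "(y - c) \<bullet> (a - c) \<le> 0"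
  proof (rule any_closest_point_dot[of S])
    show "\<forall>d\<in>S. dist y c \<le> dist y d"
    proof
      fix d assume "d \<in> S"
      then have "(norm (y - c))\<^sup>2 \<le> (norm (y - d))\<^sup>2"
        using min[OF yc(1)] N by simp
      then show "dist y c \<le> dist y d"
        unfolding dist_norm by (rule power2_le_imp_le) simp
    qed
  qed (use yc in \<open>auto simp: S_def\<close>)
  have "\<tau> * ((y - c) \<bullet> (b - a)) = - ((y - c) \<bullet> (a - c))"
    using \<tau>(2) by (metis inner_minus_right inner_scaleR_right minus_diff_eq)
  then have "(y - c) \<bullet> (b - a) \<ge> 0"
    using proj \<tau>(1) by (metis neg_0_le_iff_le zero_le_mult_iff not_less)
  then have sign: "(- (2 * N) *\<^sub>R (y - c)) \<bullet> (b - a) \<le> 0"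
    using N by simp
  have sub: "(- (2 * N) *\<^sub>R (y - c)) \<bullet> (x - y) - N * (norm (x - y))\<^sup>2 \<le> f x - f y"
    if "x \<in> ball z e" for x
  proof -
    have "(norm (x - c))\<^sup>2 = (norm (x - y))\<^sup>2 + 2 * ((y - c) \<bullet> (x - y)) + (norm (y - c))\<^sup>2"
      by (simp add: power2_norm_eq_inner algebra_simps inner_commute)
    then have "N * (norm (x - c))\<^sup>2
        = N * (norm (x - y))\<^sup>2 + 2 * N * ((y - c) \<bullet> (x - y)) + N * (norm (y - c))\<^sup>2"
      by (simp only: distrib_left mult.assoc mult.left_commute)
    then show ?thesis
      using min[of x c] that yc by simp
  qed
  show thesis
    by (rule that[OF y _ sign sub]) (use NC N in auto)
qed

section \<open>Second-order subdifferential along a sequence\<close>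

text \<open>
  This is the easy half of the scalarisation of the coderivative: proximal subgradients of
  \<open>w \<bullet> G\<close> belong to the Frechet coderivative of \<open>G\<close>, evaluated at \<open>w\<close>. Points of the graph
  are at least as far apart as their first components, so the quadratic error is of
  second order along the graph as well.
\<close>

lemma frechet_normal_graph:
  fixes G :: "'a::euclidean_space \<Rightarrow> 'a"
  assumes U: "open U" "y \<in> U"
    and sub: "\<And>x. x \<in> U \<Longrightarrow> u \<bullet> (x - y) - K * (norm (x - y))\<^sup>2 \<le> w \<bullet> G x - w \<bullet> G y"
  shows "(u, - w) \<in> frechet_normal_cone (y, G y) (range (\<lambda>x. (x, G x)))"
proof -
  let ?A = "at (y, G y) within range (\<lambda>x. (x, G x))"
  let ?Q = "\<lambda>P. (u, - w) \<bullet> (P - (y, G y)) / norm (P - (y, G y))"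
  have bound: "?Q (x, G x) \<le> \<bar>K\<bar> * dist (x, G x) (y, G y)" if "x \<in> U" for x
  proof -
    let ?d = "norm ((x, G x) - (y, G y))"
    have "norm (x - y) \<le> ?d"
      by (simp add: norm_Pair)
    then have "(norm (x - y))\<^sup>2 \<le> ?d\<^sup>2"
      by (intro power_mono) auto
    then have "\<bar>K\<bar> * (norm (x - y))\<^sup>2 \<le> \<bar>K\<bar> * ?d\<^sup>2"
      by (rule mult_left_mono) simp
    moreover have "K * (norm (x - y))\<^sup>2 \<le> \<bar>K\<bar> * (norm (x - y))\<^sup>2"
      by (intro mult_right_mono) auto
    ultimately have "(u, - w) \<bullet> ((x, G x) - (y, G y)) \<le> \<bar>K\<bar> * ?d\<^sup>2"
      using sub[OF that] by (simp add: inner_diff_right)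
    then show ?thesis
      by (cases "?d = 0") (auto simp: dist_norm divide_le_eq power2_eq_square mult.assoc)
  qed
  have "Limsup ?A (\<lambda>P. ereal (?Q P)) \<le> ereal \<epsilon>" if "\<epsilon> > 0" for \<epsilon>
  proof (rule Limsup_bounded)
    have "((\<lambda>P. \<bar>K\<bar> * dist P (y, G y)) \<longlongrightarrow> \<bar>K\<bar> * dist (y, G y) (y, G y)) ?A"
      by (intro tendsto_intros)
    then have "\<forall>\<^sub>F P in ?A. \<bar>K\<bar> * dist P (y, G y) < \<epsilon>"
      using that by (intro order_tendstoD(2)) auto
    moreover have "\<forall>\<^sub>F P in ?A. fst P \<in> U"
    proof -
      have "(fst \<longlongrightarrow> fst (y, G y)) ?A"
        by (intro tendsto_intros)
      then show ?thesis
        using U by (auto dest: topological_tendstoD)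
    qed
    moreover have "\<forall>\<^sub>F P in ?A. P \<in> range (\<lambda>x. (x, G x))"
      by (auto simp: eventually_at_filter)
    ultimately show "\<forall>\<^sub>F P in ?A. ereal (?Q P) \<le> ereal \<epsilon>"
    proof eventually_elim
      case (elim P)
      then show ?case
        using bound by fastforce
    qed
  qed
  then have "Limsup ?A (\<lambda>P. ereal (?Q P)) \<le> 0 + ereal \<epsilon>" if "\<epsilon> > 0" for \<epsilon>
    using that by simp
  then have "Limsup ?A (\<lambda>P. ereal (?Q P)) \<le> 0"
    by (rule ereal_le_epsilon2)
  then show ?thesis
    by (simp add: frechet_normal_cone_def)
qed

text \<open>
  One step of the construction. With \<open>w = sgn (x - x0)\<close>, the auxiliary function
  \<open>y \<mapsto> w \<bullet> G y - 2 * \<epsilon> * (w \<bullet> y)\<close> is smaller at some point of the segment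
  than at its start \<open>x0\<close>, and the nonsmooth mean value inequality applies to it.
\<close>

lemma second_order_mean_value:
  fixes F :: "'a::euclidean_space \<Rightarrow> real"
  assumes D: "\<And>x. GDERIV F x :> G x"
    and lip: "C-lipschitz_on (cball x0 e) G"
    and crit: "G x0 = 0"
    and x: "x \<noteq> x0" "norm (x - x0) < e"
    and \<epsilon>: "\<epsilon> \<ge> 0" "F x - F x0 < \<epsilon> * (norm (x - x0))\<^sup>2"
  obtains y u where "y \<in> ball x0 e" "norm u \<le> 2 * C + 6 * \<epsilon>" "u \<bullet> sgn (x - x0) \<le> 2 * \<epsilon>"
    "(u, - sgn (x - x0)) \<in> frechet_normal_cone (y, G y) (range (\<lambda>y. (y, G y)))"
proof -
  define t where "t = norm (x - x0)"
  define w where "w = sgn (x - x0)"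
  have t: "t > 0" "t < e"
    using x by (simp_all add: t_def)
  have w: "norm w = 1"
    using x(1) by (simp add: w_def norm_sgn)
  have "t *\<^sub>R w = x - x0"
    using x(1) by (simp add: t_def w_def sgn_div_norm)
  then have tw: "x0 + t *\<^sub>R w = x"
    by simp
  define l where "l = (\<lambda>s. F (x0 + s *\<^sub>R w) - \<epsilon> * s\<^sup>2)"
  have l': "(l has_real_derivative w \<bullet> G (x0 + s *\<^sub>R w) - 2 * \<epsilon> * s) (at s)" for s
  proof -
    have "((\<lambda>s. x0 + s *\<^sub>R w) has_derivative (\<lambda>h. h *\<^sub>R w)) (at s)"
      by (auto intro!: derivative_eq_intros)
    from has_derivative_compose[OF this D[of "x0 + s *\<^sub>R w", unfolded gderiv_def]]
    have "((\<lambda>s. F (x0 + s *\<^sub>R w)) has_real_derivative w \<bullet> G (x0 + s *\<^sub>R w)) (at s)"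
      by (simp add: has_field_derivative_def mult_commute_abs)
    then show ?thesis
      unfolding l_def by (auto intro!: derivative_eq_intros)
  qed
  obtain s where s: "0 < s" "s < t" "l t - l 0 = (t - 0) * (w \<bullet> G (x0 + s *\<^sub>R w) - 2 * \<epsilon> * s)"
    using MVT2[OF t(1) l'] by blast
  have "l t - l 0 < 0"
    using \<epsilon>(2) by (simp add: l_def tw flip: t_def)
  then have neg: "w \<bullet> G (x0 + s *\<^sub>R w) - 2 * \<epsilon> * s < 0"
    using s(3) t(1) by (simp add: mult_less_0_iff)
  define f where "f = (\<lambda>y. w \<bullet> G y - 2 * \<epsilon> * (w \<bullet> y))"
  have lip_f: "(C + 2 * \<epsilon>)-lipschitz_on (cball x0 e) f"
  proof (rule lipschitz_onI)
    fix y y' assume y: "y \<in> cball x0 e" "y' \<in> cball x0 e"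
    have "f y - f y' = w \<bullet> (G y - G y') - 2 * \<epsilon> * (w \<bullet> (y - y'))"
      by (simp add: f_def algebra_simps)
    also have "\<bar>\<dots>\<bar> \<le> \<bar>w \<bullet> (G y - G y')\<bar> + 2 * \<epsilon> * \<bar>w \<bullet> (y - y')\<bar>"
      using \<epsilon>(1) by (intro order.trans[OF abs_triangle_ineq4]) (simp add: abs_mult)
    also have "\<dots> \<le> norm (G y - G y') + 2 * \<epsilon> * norm (y - y')"
      using \<epsilon>(1) Cauchy_Schwarz_ineq2[of w "G y - G y'"] Cauchy_Schwarz_ineq2[of w "y - y'"]
      by (intro add_mono mult_left_mono) (simp_all add: w)
    also have "\<dots> \<le> C * norm (y - y') + 2 * \<epsilon> * norm (y - y')"
      using lipschitz_onD[OF lip y] by (simp add: dist_norm)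
    finally show "dist (f y) (f y') \<le> (C + 2 * \<epsilon>) * dist y y'"
      by (simp add: dist_norm algebra_simps)
  qed (use lipschitz_on_nonneg[OF lip] \<epsilon>(1) in simp)
  have "f (x0 + s *\<^sub>R w) < f x0"
    using neg w by (simp add: f_def crit algebra_simps norm_eq_1)
  moreover have "x0 \<in> ball x0 e" "x0 + s *\<^sub>R w \<in> ball x0 e"
    using s t w by (auto simp: dist_norm)
  ultimately obtain y u K where y: "y \<in> ball x0 e" and u: "norm u \<le> 2 * (C + 2 * \<epsilon>)"
      "u \<bullet> (x0 + s *\<^sub>R w - x0) \<le> 0"
    and sub: "\<And>x. x \<in> ball x0 e \<Longrightarrow> u \<bullet> (x - y) - K * (norm (x - y))\<^sup>2 \<le> f x - f y"
    using proximal_mean_value[OF lip_f] by metis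
  have "(u + (2 * \<epsilon>) *\<^sub>R w) \<bullet> (x - y) - K * (norm (x - y))\<^sup>2 \<le> w \<bullet> G x - w \<bullet> G y"
    if "x \<in> ball x0 e" for x
    using sub[OF that] by (simp add: f_def algebra_simps)
  then have normal: "(u + (2 * \<epsilon>) *\<^sub>R w, - w) \<in> frechet_normal_cone (y, G y) (range (\<lambda>y. (y, G y)))"
    using y by (intro frechet_normal_graph[of "ball x0 e"]) auto
  have "norm (u + (2 * \<epsilon>) *\<^sub>R w) \<le> 2 * C + 6 * \<epsilon>"
    using norm_triangle_ineq[of u "(2 * \<epsilon>) *\<^sub>R w"] u(1) w \<epsilon>(1) by simp
  moreover have "(u + (2 * \<epsilon>) *\<^sub>R w) \<bullet> w \<le> 2 * \<epsilon>"
    using u(2) s(1) w by (simp add: inner_add_left norm_eq_1 mult_le_0_iff)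
  ultimately show thesis
    using that[OF y] normal by (simp add: w_def)
qed

text \<open>
  Second-order necessary condition at a critical point along which \<open>F\<close> fails to grow
  quadratically: the vectors \<open>u\<close> provided by the previous lemma are bounded, and any
  limit point of them is the required \<open>z\<close>.
\<close>

lemma limiting_second_subdiff_nonpos:
  fixes F :: "'a::euclidean_space \<Rightarrow> real"
  assumes F: "C11 F"
    and crit: "gradient F x0 = 0"
    and x: "x \<longlonglongrightarrow> x0" "\<And>k. x k \<noteq> x0"
    and v: "(\<lambda>k. sgn (x k - x0)) \<longlonglongrightarrow> v"
    and \<epsilon>: "\<epsilon> \<longlonglongrightarrow> 0" "\<And>k. \<epsilon> k \<ge> 0"
    and le: "\<And>k. F (x k) - F x0 < \<epsilon> k * (norm (x k - x0))\<^sup>2"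
  obtains z where "z \<in> limiting_second_subdiff F x0 v" "z \<bullet> v \<le> 0"
proof -
  let ?G = "gradient F"
  let ?N = "\<lambda>y. frechet_normal_cone (y, ?G y) (range (\<lambda>y. (y, ?G y)))"
  obtain e C where e: "e > 0" and lip: "C-lipschitz_on (ball x0 e) ?G"
    using C11_locally_lipschitz[OF F] by blast
  have t0: "(\<lambda>k. norm (x k - x0)) \<longlonglongrightarrow> 0"
    using x(1) by (simp add: LIM_zero tendsto_norm_zero)
  have "\<forall>\<^sub>F k in sequentially. norm (x k - x0) < e / 2"
    using t0 e by (intro order_tendstoD(2)) auto
  moreover have "\<forall>\<^sub>F k in sequentially. \<epsilon> k < 1"
    using \<epsilon>(1) by (intro order_tendstoD(2)) auto
  ultimately have "\<forall>\<^sub>F k in sequentially. norm (x k - x0) < e / 2 \<and> \<epsilon> k < 1"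
    by (rule eventually_conj)
  then obtain k0 where k0: "\<And>k. k \<ge> k0 \<Longrightarrow> norm (x k - x0) < e / 2 \<and> \<epsilon> k < 1"
    by (auto simp: eventually_sequentially)
  define P where "P k y u \<longleftrightarrow> norm (y - x0) < 2 * norm (x (k + k0) - x0) \<and> norm u \<le> 2 * C + 6 \<and>
    u \<bullet> sgn (x (k + k0) - x0) \<le> 2 * \<epsilon> (k + k0) \<and> (u, - sgn (x (k + k0) - x0)) \<in> ?N y" for k y u
  have "\<exists>y u. P k y u" for k
  proof -
    let ?x = "x (k + k0)"
    have small: "norm (?x - x0) < e / 2" "\<epsilon> (k + k0) < 1"
      using k0 by auto
    have "C-lipschitz_on (cball x0 (2 * norm (?x - x0))) ?G"
      using small(1) by (intro lipschitz_on_subset[OF lip]) auto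
    moreover have "norm (?x - x0) < 2 * norm (?x - x0)"
      using x(2) by simp
    ultimately obtain y u where "y \<in> ball x0 (2 * norm (?x - x0))" "norm u \<le> 2 * C + 6 * \<epsilon> (k + k0)"
        "u \<bullet> sgn (?x - x0) \<le> 2 * \<epsilon> (k + k0)" "(u, - sgn (?x - x0)) \<in> ?N y"
      using second_order_mean_value[OF C11_GDERIV[OF F] _ crit x(2) _ \<epsilon>(2) le] by blast
    then show ?thesis
      using small(2) by (intro exI[of _ y] exI[of _ u]) (auto simp: P_def dist_norm norm_minus_commute)
  qed
  then obtain y u where P: "\<And>k. P k (y k) (u k)"
    by metis
  then have y: "\<And>k. norm (y k - x0) < 2 * norm (x (k + k0) - x0)"
    and u: "\<And>k. norm (u k) \<le> 2 * C + 6" "\<And>k. u k \<bullet> sgn (x (k + k0) - x0) \<le> 2 * \<epsilon> (k + k0)"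
    and normal: "\<And>k. (u k, - sgn (x (k + k0) - x0)) \<in> ?N (y k)"
    by (simp_all add: P_def)
  have "bounded (range u)"
    using u(1) by (auto simp: bounded_iff)
  then obtain z r where r: "strict_mono r" and z: "(u \<circ> r) \<longlonglongrightarrow> z"
    using bounded_imp_convergent_subsequence by blast
  have v': "(\<lambda>k. sgn (x (r k + k0) - x0)) \<longlonglongrightarrow> v"
    using LIMSEQ_subseq_LIMSEQ[OF LIMSEQ_ignore_initial_segment[OF v] r] by (simp add: o_def)
  have y': "(\<lambda>k. y (r k)) \<longlonglongrightarrow> x0"
  proof -
    have "(\<lambda>k. 2 * norm (x (k + k0) - x0)) \<longlonglongrightarrow> 0"
      using tendsto_mult_right_zero[OF LIMSEQ_ignore_initial_segment[OF t0]] by simp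
    then have "(\<lambda>k. y k - x0) \<longlonglongrightarrow> 0"
      by (rule Lim_null_comparison[rotated]) (use y in \<open>auto intro!: always_eventually less_imp_le\<close>)
    then have "y \<longlonglongrightarrow> x0"
      by (rule LIM_zero_cancel)
    from LIMSEQ_subseq_LIMSEQ[OF this r] show ?thesis
      by (simp add: o_def)
  qed
  have "isCont ?G x0"
    using lipschitz_on_continuous_on[OF lip] e by (simp add: continuous_on_eq_continuous_at)
  then have "(\<lambda>k. ?G (y (r k))) \<longlonglongrightarrow> ?G x0"
    using y' by (rule isCont_tendsto_compose)
  then have graph_lim: "(\<lambda>k. (y (r k), ?G (y (r k)))) \<longlonglongrightarrow> (x0, ?G x0)"
    using y' by (intro tendsto_Pair)
  have normal_lim: "(\<lambda>k. (u (r k), - sgn (x (r k + k0) - x0))) \<longlonglongrightarrow> (z, - v)"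
    using z v' by (intro tendsto_Pair tendsto_minus) (simp_all add: o_def)
  have "z \<in> limiting_second_subdiff F x0 v"
    unfolding limiting_second_subdiff_def limiting_normal_cone_def mem_Collect_eq
  proof (rule exI, rule exI, intro conjI allI)
    show "(\<lambda>k. (y (r k), ?G (y (r k)))) \<longlonglongrightarrow> (x0, ?G x0)"
      by (rule graph_lim)
    show "(\<lambda>k. (u (r k), - sgn (x (r k + k0) - x0))) \<longlonglongrightarrow> (z, - v)"
      by (rule normal_lim)
    show "(y (r k), ?G (y (r k))) \<in> range (\<lambda>y. (y, ?G y))" for k
      by (rule rangeI)
    show "(u (r k), - sgn (x (r k + k0) - x0)) \<in> ?N (y (r k))" for k
      by (rule normal)
  qed
  moreover have "z \<bullet> v \<le> 0"
  proof (rule LIMSEQ_le)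
    show "(\<lambda>k. u (r k) \<bullet> sgn (x (r k + k0) - x0)) \<longlonglongrightarrow> z \<bullet> v"
      using z v' by (intro tendsto_inner) (simp_all add: o_def)
    show "(\<lambda>k. 2 * \<epsilon> (r k + k0)) \<longlonglongrightarrow> 0"
      using tendsto_mult_right_zero[OF LIMSEQ_subseq_LIMSEQ[OF
          LIMSEQ_ignore_initial_segment[OF \<epsilon>(1)] r]] by (simp add: o_def)
  qed (use u(2) in auto)
  ultimately show thesis
    by (rule that)
qed

section \<open>The multiobjective problem\<close>

lemma gradient_lagrangian:
  assumes "\<And>l. l \<in> {1..q} \<Longrightarrow> C11 (\<phi> l)"
    and "\<And>i. i \<in> {1..m} \<Longrightarrow> C11 (g i)"
    and "\<And>j. j \<in> {1..p} \<Longrightarrow> C11 (h j)"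
  shows "gradient (\<lambda>y. lagrangian q m p \<phi> g h y \<alpha> lam \<mu>) x =
    (\<Sum>l\<in>{1..q}. \<alpha> l *\<^sub>R gradient (\<phi> l) x) + (\<Sum>i\<in>{1..m}. lam i *\<^sub>R gradient (g i) x)
      + (\<Sum>j\<in>{1..p}. \<mu> j *\<^sub>R gradient (h j) x)"
proof (rule gradient_eqI)
  have "((\<lambda>y. \<Sum>i\<in>S. c i * f i y) has_derivative
      (\<lambda>d. d \<bullet> (\<Sum>i\<in>S. c i *\<^sub>R gradient (f i) x))) (at x)"
    if "\<And>i. i \<in> S \<Longrightarrow> C11 (f i)" for S :: "nat set" and c f
    unfolding inner_sum_right inner_scaleR_right
    by (intro has_derivative_sum has_derivative_mult_right)
      (use C11_GDERIV that in \<open>auto simp: gderiv_def\<close>)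
  then show "GDERIV (\<lambda>y. lagrangian q m p \<phi> g h y \<alpha> lam \<mu>) x :>
      (\<Sum>l\<in>{1..q}. \<alpha> l *\<^sub>R gradient (\<phi> l) x) + (\<Sum>i\<in>{1..m}. lam i *\<^sub>R gradient (g i) x)
        + (\<Sum>j\<in>{1..p}. \<mu> j *\<^sub>R gradient (h j) x)"
    unfolding gderiv_def lagrangian_def inner_add_right
    by (intro has_derivative_add) (use assms in blast)+
qed

text \<open>
  Stationarity makes the multiplier-weighted slopes along \<open>v\<close> sum to zero. None of them is
  positive, since complementarity removes the inactive constraints. Hence each of them vanishes, and
  with it the slope of any objective whose multiplier is positive.
\<close>

lemma critical_directionI:
  assumes C11: "\<And>l. l \<in> {1..q} \<Longrightarrow> C11 (\<phi> l)"
    "\<And>i. i \<in> {1..m} \<Longrightarrow> C11 (g i)"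
    "\<And>j. j \<in> {1..p} \<Longrightarrow> C11 (h j)"
    and mult: "(\<alpha>, lam, \<mu>) \<in> multipliers q m p \<phi> g h x"
    and \<phi>: "\<And>l. l \<in> {1..q} \<Longrightarrow> gradient (\<phi> l) x \<bullet> v \<le> 0"
    and g: "\<And>i. i \<in> active_set m g x \<Longrightarrow> gradient (g i) x \<bullet> v \<le> 0"
    and h: "\<And>j. j \<in> {1..p} \<Longrightarrow> gradient (h j) x \<bullet> v = 0"
  shows "v \<in> critical_directions q m p \<phi> g h x"
proof -
  have \<alpha>: "\<And>l. l \<in> {1..q} \<Longrightarrow> \<alpha> l \<ge> 0" and lam: "\<And>i. i \<in> {1..m} \<Longrightarrow> lam i \<ge> 0"
    and compl: "\<And>i. i \<in> {1..m} \<Longrightarrow> lam i * g i x = 0"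
    and stat: "gradient (\<lambda>y. lagrangian q m p \<phi> g h y \<alpha> lam \<mu>) x = 0"
    using mult by (auto simp: multipliers_def)
  obtain l0 where l0: "l0 \<in> {1..q}" "\<alpha> l0 \<noteq> 0"
    using mult by (auto simp: multipliers_def)
  have "(\<Sum>l\<in>{1..q}. \<alpha> l *\<^sub>R gradient (\<phi> l) x) + (\<Sum>i\<in>{1..m}. lam i *\<^sub>R gradient (g i) x)
      + (\<Sum>j\<in>{1..p}. \<mu> j *\<^sub>R gradient (h j) x) = 0"
    using gradient_lagrangian[of q \<phi> m g p h \<alpha> lam \<mu> x] C11 stat by simp
  from arg_cong[OF this, of "\<lambda>d. d \<bullet> v"]
  have "(\<Sum>l\<in>{1..q}. \<alpha> l * (gradient (\<phi> l) x \<bullet> v)) + (\<Sum>i\<in>{1..m}. lam i * (gradient (g i) x \<bullet> v))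
      + (\<Sum>j\<in>{1..p}. \<mu> j * (gradient (h j) x \<bullet> v)) = 0"
    by (simp add: inner_add_left inner_sum_left)
  moreover have "(\<Sum>j\<in>{1..p}. \<mu> j * (gradient (h j) x \<bullet> v)) = 0"
    using h by simp
  moreover have "(\<Sum>i\<in>{1..m}. lam i * (gradient (g i) x \<bullet> v)) \<le> 0"
  proof (rule sum_nonpos)
    fix i assume i: "i \<in> {1..m}"
    show "lam i * (gradient (g i) x \<bullet> v) \<le> 0"
    proof (cases "g i x = 0")
      case True
      then show ?thesis
        using i g[of i] lam[OF i] by (auto simp: active_set_def intro: mult_nonneg_nonpos)
    qed (use compl[OF i] in simp)
  qed
  moreover have \<phi>_nonpos: "\<alpha> l * (gradient (\<phi> l) x \<bullet> v) \<le> 0" if "l \<in> {1..q}" for l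
    using \<alpha> \<phi> that by (intro mult_nonneg_nonpos)
  moreover have "(\<Sum>l\<in>{1..q}. \<alpha> l * (gradient (\<phi> l) x \<bullet> v)) \<le> 0"
    using \<phi>_nonpos by (rule sum_nonpos)
  ultimately have "(\<Sum>l\<in>{1..q}. \<alpha> l * (gradient (\<phi> l) x \<bullet> v)) = 0"
    by linarith
  then have "\<alpha> l0 * (gradient (\<phi> l0) x \<bullet> v) = 0"
    using sum_nonneg_eq_0_iff[of "{1..q}" "\<lambda>l. - (\<alpha> l * (gradient (\<phi> l) x \<bullet> v))"]
      \<phi>_nonpos l0(1) by (simp add: sum_negf)
  then show ?thesis
    using \<phi> g h l0 by (auto simp: critical_directions_def)
qed

text \<open>
  The constraint terms of the Lagrangian vanish at \<open>x0\<close> and are nonpositive on the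
  feasible set, so a bound on the growth of all objectives passes to the Lagrangian.
\<close>

lemma lagrangian_growth_le:
  assumes mult: "(\<alpha>, lam, \<mu>) \<in> multipliers q m p \<phi> g h x0"
    and feas: "x0 \<in> feasible_set m p g h" "x \<in> feasible_set m p g h"
    and le: "\<And>l. l \<in> {1..q} \<Longrightarrow> \<phi> l x - \<phi> l x0 \<le> B"
  shows "lagrangian q m p \<phi> g h x \<alpha> lam \<mu> - lagrangian q m p \<phi> g h x0 \<alpha> lam \<mu>
    \<le> (\<Sum>l\<in>{1..q}. \<alpha> l) * B"
proof -
  have \<alpha>: "\<And>l. l \<in> {1..q} \<Longrightarrow> \<alpha> l \<ge> 0" and lam: "\<And>i. i \<in> {1..m} \<Longrightarrow> lam i \<ge> 0"
    and compl: "\<And>i. i \<in> {1..m} \<Longrightarrow> lam i * g i x0 = 0"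
    using mult by (auto simp: multipliers_def)
  have "(\<Sum>l\<in>{1..q}. \<alpha> l * \<phi> l x) - (\<Sum>l\<in>{1..q}. \<alpha> l * \<phi> l x0)
      = (\<Sum>l\<in>{1..q}. \<alpha> l * (\<phi> l x - \<phi> l x0))"
    by (simp add: algebra_simps sum_subtractf)
  also have "\<dots> \<le> (\<Sum>l\<in>{1..q}. \<alpha> l * B)"
    using \<alpha> le by (intro sum_mono mult_left_mono)
  finally have "(\<Sum>l\<in>{1..q}. \<alpha> l * \<phi> l x) - (\<Sum>l\<in>{1..q}. \<alpha> l * \<phi> l x0)
      \<le> (\<Sum>l\<in>{1..q}. \<alpha> l) * B"
    by (simp add: sum_distrib_right)
  moreover have "(\<Sum>i\<in>{1..m}. lam i * g i x) \<le> 0"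
    using lam feas(2) by (intro sum_nonpos mult_nonneg_nonpos) (auto simp: feasible_set_def)
  moreover have "(\<Sum>i\<in>{1..m}. lam i * g i x0) = 0"
    using compl by (intro sum.neutral) blast
  moreover have "(\<Sum>j\<in>{1..p}. \<mu> j * h j y) = 0" if "y \<in> feasible_set m p g h" for y
    using that by (intro sum.neutral) (auto simp: feasible_set_def)
  ultimately show ?thesis
    using feas by (simp add: lagrangian_def)
qed

text \<open>
  The radius of the neighbourhood and the growth constant are both taken to be \<open>1 / (k + 1)\<close>.
  The points so obtained differ from \<open>x0\<close> because the growth bound is strict, and compactness of the
  unit sphere gives a subsequence along which their directions converge.
\<close>

lemma not_isolated_sequence:
  fixes x0 :: "'a::euclidean_space"
  assumes x0: "x0 \<in> feasible_set m p g h"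
    and q: "q \<ge> 1"
    and not_iso: "\<not> isolated_local_solution_order2 q m p \<phi> g h x0"
  obtains x v and \<epsilon> :: "nat \<Rightarrow> real" where
    "\<And>k. x k \<in> feasible_set m p g h" "\<And>k. x k \<noteq> x0" "x \<longlonglongrightarrow> x0"
    "(\<lambda>k. sgn (x k - x0)) \<longlonglongrightarrow> v" "norm v = 1" "\<epsilon> \<longlonglongrightarrow> 0" "\<And>k. \<epsilon> k > 0"
    "\<And>k l. l \<in> {1..q} \<Longrightarrow> \<phi> l (x k) - \<phi> l x0 < \<epsilon> k * (norm (x k - x0))\<^sup>2"
proof -
  define \<epsilon> :: "nat \<Rightarrow> real" where "\<epsilon> k = inverse (real (Suc k))" for k
  have \<epsilon>: "\<epsilon> k > 0" for k
    by (simp add: \<epsilon>_def)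
  have \<epsilon>_lim: "\<epsilon> \<longlonglongrightarrow> 0"
    unfolding \<epsilon>_def by (rule LIMSEQ_inverse_real_of_nat)
  have "\<exists>x. x \<in> feasible_set m p g h \<inter> ball x0 (\<epsilon> k) \<and>
      \<not> Max ((\<lambda>l. \<phi> l x - \<phi> l x0) ` {1..q}) \<ge> \<epsilon> k * (norm (x - x0))\<^sup>2" for k
  proof (rule ccontr)
    assume "\<not> ?thesis"
    then have "\<forall>x \<in> feasible_set m p g h \<inter> ball x0 (\<epsilon> k).
        Max ((\<lambda>l. \<phi> l x - \<phi> l x0) ` {1..q}) \<ge> \<epsilon> k * (norm (x - x0))\<^sup>2"
      by blast
    moreover have "open (ball x0 (\<epsilon> k))" "x0 \<in> ball x0 (\<epsilon> k)"
      using \<epsilon>[of k] by simp_all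
    ultimately have "isolated_local_solution_order2 q m p \<phi> g h x0"
      using x0 \<epsilon>[of k] unfolding isolated_local_solution_order2_def by blast
    with not_iso show False ..
  qed
  then have "\<forall>k. \<exists>x. x \<in> feasible_set m p g h \<inter> ball x0 (\<epsilon> k) \<and>
      \<not> Max ((\<lambda>l. \<phi> l x - \<phi> l x0) ` {1..q}) \<ge> \<epsilon> k * (norm (x - x0))\<^sup>2"
    by (rule allI)
  from choice[OF this] obtain x where x: "\<And>k. x k \<in> feasible_set m p g h"
      "\<And>k. x k \<in> ball x0 (\<epsilon> k)"
    and Max: "\<And>k. Max ((\<lambda>l. \<phi> l (x k) - \<phi> l x0) ` {1..q}) < \<epsilon> k * (norm (x k - x0))\<^sup>2"
    unfolding Int_iff not_le by blast
  have growth: "\<phi> l (x k) - \<phi> l x0 < \<epsilon> k * (norm (x k - x0))\<^sup>2" if "l \<in> {1..q}" for k l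
    using Max[of k] that by (subst (asm) Max_less_iff) auto
  have ne: "x k \<noteq> x0" for k
    using growth[of 1 k] q by auto
  have "(\<lambda>k. x k - x0) \<longlonglongrightarrow> 0"
    using x(2) by (intro Lim_null_comparison[OF _ \<epsilon>_lim] always_eventually)
      (auto simp: dist_norm norm_minus_commute less_imp_le)
  then have lim: "x \<longlonglongrightarrow> x0"
    by (rule LIM_zero_cancel)
  have sphere: "sgn (x k - x0) \<in> sphere 0 1" for k
    using ne[of k] by (simp add: norm_sgn)
  obtain v r where v: "v \<in> sphere 0 1" and r: "strict_mono r"
    and dir: "((\<lambda>k. sgn (x k - x0)) \<circ> r) \<longlonglongrightarrow> v"
    using seq_compactE[OF compact_imp_seq_compact[OF compact_sphere[of "0::'a" 1]],
        of "\<lambda>k. sgn (x k - x0)"] sphere by blast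
  show thesis
  proof (rule that[of "x \<circ> r" v "\<epsilon> \<circ> r"])
    show "(x \<circ> r) \<longlonglongrightarrow> x0" "(\<epsilon> \<circ> r) \<longlonglongrightarrow> 0"
      using lim \<epsilon>_lim r by (auto intro: LIMSEQ_subseq_LIMSEQ)
  qed (use x(1) ne dir v \<epsilon> growth in \<open>auto simp: o_def\<close>)
qed

theorem theorem5p4:
  fixes q m p :: nat
    and \<phi> g h :: "nat \<Rightarrow> 'a::euclidean_space \<Rightarrow> real"
    and x0 :: 'a
    and \<alpha> lam \<mu> :: "nat \<Rightarrow> real"
  assumes "\<And>l. l \<in> {1..q} \<Longrightarrow> C11 (\<phi> l)"
    and "\<And>i. i \<in> {1..m} \<Longrightarrow> C11 (g i)"
    and "\<And>j. j \<in> {1..p} \<Longrightarrow> C11 (h j)"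
    and "x0 \<in> feasible_set m p g h"
    and "stationary_point q m p \<phi> g h x0"
    and "(\<alpha>, lam, \<mu>) \<in> multipliers q m p \<phi> g h x0"
    and "\<And>v z. \<lbrakk> v \<in> (contingent_cone x0 (feasible_set m p g h)
                      \<inter> critical_directions q m p \<phi> g h x0) - {0};
                 z \<in> limiting_second_subdiff (\<lambda>x. lagrangian q m p \<phi> g h x \<alpha> lam \<mu>) x0 v \<rbrakk>
               \<Longrightarrow> z \<bullet> v > 0"
  shows "isolated_local_solution_order2 q m p \<phi> g h x0"
proof (rule ccontr)
  assume not_iso: "\<not> isolated_local_solution_order2 q m p \<phi> g h x0"
  let ?X = "feasible_set m p g h"
  let ?F = "\<lambda>x. lagrangian q m p \<phi> g h x \<alpha> lam \<mu>"
  note C11 = assms(1-3) and x0 = assms(4) and mult = assms(6)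
  have "q \<ge> 1"
    using mult by (auto simp: multipliers_def)
  from not_isolated_sequence[OF x0 this not_iso]
  obtain x v and \<epsilon> :: "nat \<Rightarrow> real" where feas: "\<And>k. x k \<in> ?X"
    and ne: "\<And>k. x k \<noteq> x0" and lim: "x \<longlonglongrightarrow> x0"
    and dir: "(\<lambda>k. sgn (x k - x0)) \<longlonglongrightarrow> v" and v: "norm v = 1"
    and \<epsilon>_lim: "\<epsilon> \<longlonglongrightarrow> 0" and \<epsilon>: "\<And>k. \<epsilon> k > 0"
    and growth: "\<And>k l. l \<in> {1..q} \<Longrightarrow> \<phi> l (x k) - \<phi> l x0 < \<epsilon> k * (norm (x k - x0))\<^sup>2"
    by metis
  have t_lim: "(\<lambda>k. norm (x k - x0)) \<longlonglongrightarrow> 0"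
    using lim by (simp add: LIM_zero tendsto_norm_zero)
  have slope: "(\<lambda>k. (f (x k) - f x0) / norm (x k - x0)) \<longlonglongrightarrow> gradient f x0 \<bullet> v" if "C11 f" for f
    using GDERIV_directional_limit[OF C11_GDERIV[OF that] lim ne dir] .

  have "v \<in> contingent_cone x0 ?X"
    unfolding contingent_cone_def using feas ne t_lim dir
    by (auto intro!: exI[of _ "\<lambda>k. norm (x k - x0)"] exI[of _ "\<lambda>k. sgn (x k - x0)"]
        simp: sgn_div_norm)
  moreover have "v \<in> critical_directions q m p \<phi> g h x0"
  proof (rule critical_directionI[OF C11 mult])
    fix l assume l: "l \<in> {1..q}"
    show "gradient (\<phi> l) x0 \<bullet> v \<le> 0"
    proof (rule LIMSEQ_le[OF slope[OF C11(1)[OF l]]])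
      show "(\<lambda>k. \<epsilon> k * norm (x k - x0)) \<longlonglongrightarrow> 0"
        using tendsto_mult[OF \<epsilon>_lim t_lim] by simp
      show "\<exists>k0. \<forall>k\<ge>k0. (\<phi> l (x k) - \<phi> l x0) / norm (x k - x0) \<le> \<epsilon> k * norm (x k - x0)"
        using growth[OF l] ne
        by (auto simp: divide_le_eq power2_eq_square mult.assoc less_imp_le)
    qed
  next
    fix i assume i: "i \<in> active_set m g x0"
    show "gradient (g i) x0 \<bullet> v \<le> 0"
    proof (rule LIMSEQ_le_const2[OF slope])
      show "C11 (g i)"
        using i C11(2) by (simp add: active_set_def)
      show "\<exists>k0. \<forall>k\<ge>k0. (g i (x k) - g i x0) / norm (x k - x0) \<le> 0"
        using i feas by (auto simp: active_set_def feasible_set_def divide_le_0_iff)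
    qed
  next
    fix j assume j: "j \<in> {1..p}"
    have "h j (x k) - h j x0 = 0" for k
      using j feas[of k] x0 by (auto simp: feasible_set_def)
    then have "(\<lambda>k. 0) \<longlonglongrightarrow> gradient (h j) x0 \<bullet> v"
      using slope[OF C11(3)[OF j]] by simp
    then show "gradient (h j) x0 \<bullet> v = 0"
      by (simp add: LIMSEQ_const_iff)
  qed
  moreover have "v \<noteq> 0"
    using v by auto
  ultimately have pos: "z \<bullet> v > 0" if "z \<in> limiting_second_subdiff ?F x0 v" for z
    using assms(7) that by blast

  define A where "A = (\<Sum>l\<in>{1..q}. \<alpha> l)"
  have A: "A \<ge> 0"
    using mult by (auto simp: A_def multipliers_def intro: sum_nonneg)
  (* The summand 1 gives the strict inequality that second-order mean values start from. *)
  have F_growth: "?F (x k) - ?F x0 < (A + 1) * \<epsilon> k * (norm (x k - x0))\<^sup>2" for k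
  proof -
    have "?F (x k) - ?F x0 \<le> A * (\<epsilon> k * (norm (x k - x0))\<^sup>2)"
      unfolding A_def using growth by (intro lagrangian_growth_le mult x0 feas less_imp_le)
    moreover have "0 < \<epsilon> k * (norm (x k - x0))\<^sup>2"
      using \<epsilon> ne by simp
    ultimately show ?thesis
      by (simp add: algebra_simps)
  qed
  have "gradient ?F x0 = 0"
    using mult by (simp add: multipliers_def)
  moreover have "(\<lambda>k. (A + 1) * \<epsilon> k) \<longlonglongrightarrow> 0"
    using \<epsilon>_lim by (rule tendsto_mult_right_zero)
  moreover have "(A + 1) * \<epsilon> k \<ge> 0" for k
    using A \<epsilon>[of k] by simp
  ultimately obtain z where "z \<in> limiting_second_subdiff ?F x0 v" "z \<bullet> v \<le> 0"
    using limiting_second_subdiff_nonpos[OF C11_lagrangian[OF C11] _ lim ne dir _ _ F_growth]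
    by blast
  with pos show False
    by fastforce
qed

end
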